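(* Assume $\mathrm{cf}(\kappa)=\omega$. There is a complete embedding of the Boolean algebra $\mathcal{P}(\omega)/\mathrm{Fin}$ into $\mathbb{B}$, the regular open completion of $\mathbb{P}$.
   Context: $\kappa$ is a singular cardinal and $\langle \kappa_n:n<\omega\rangle$ is a strictly increasing sequence of regular cardinals with supremum $\kappa$ such that $\omega<\kappa_n<\kappa$ for all $n$. Standing assumption: $\mu^{\omega}<\kappa$ for every cardinal $\mu<\kappa$. Let $N$ be the set of finite sequences $t$ with $t(i)<\kappa_i$ for all $i\in\mathrm{dom}(t)$, and $X$ the set of functions $f$ on $\omega$ with $f(i)<\kappa_i$. A tree is a subset $T\subseteq N$ closed under initial segments; $[T]=\{f\in X: f\restriction n\in T\ \forall n\}$; $\mathrm{Succ}_T(t)$ is the set of one-point extensions of $t$ in $T$. A tree $T$ is perfect if it is nonempty, every $t\in T$ has an extension in $[T]$, and for every $n$ and $t\in T$ there is $t'\in T$ extending $t$ with $|\mathrm{Succ}_T(t')|\ge\kappa_n$. $\mathbb{P}$ is the set of perfect trees ordered by inclusion. A map $i$ between complete Boolean algebras $\mathbb{S}\to\mathbb{T}$ is a complete embedding iff it is order preserving on nonzero elements, preserves and reflects incompatibility, and for every nonzero $t\in\mathbb{T}$ there is nonzero $s\in\mathbb{S}$ such that $i(s')$ is compatible with $t$ for all nonzero $s'\le s$. *)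

theory Defs
  imports
    "HOL-Analysis.Abstract_Topology"
    "HOL-Library.Sublist"
    "HOL-Algebra.Lattice"
begin

text \<open>
  Cardinals are cardinal orders (\<^const>\<open>Card_order\<close>); an ordinal below the cardinal
  \<open>\<kappa>\<close> is an element of \<open>Field \<kappa>\<close>. Cardinals are compared with \<open>\<le>o\<close> and
  \<open><o\<close>, so the \<open>K n\<close> below need not be initial segments of \<open>\<kappa>\<close>.
\<close>

unbundle cardinal_syntax

section \<open>Cofinality\<close>

definition has_cofinality :: "'a rel \<Rightarrow> 'b rel \<Rightarrow> bool" where
  "has_cofinality \<kappa> \<mu> \<longleftrightarrow> Card_order \<mu> \<and>
     (\<exists>A \<subseteq> Field \<kappa>. cofinal A \<kappa> \<and> |A| =o \<mu>) \<and>
     (\<forall>A \<subseteq> Field \<kappa>. cofinal A \<kappa> \<longrightarrow> \<mu> \<le>o |A| )"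

definition singular_card :: "'a rel \<Rightarrow> bool" where
  "singular_card \<kappa> \<longleftrightarrow> Cinfinite \<kappa> \<and> \<not> regularCard \<kappa>"

text \<open>Least upper bounds among cardinals; \<open>\<mu>\<close> may range over the type carrying
  \<open>\<kappa>\<close>, since every cardinal below \<open>\<kappa>\<close> has a copy there.\<close>

definition is_card_sup :: "(nat \<Rightarrow> 'a rel) \<Rightarrow> 'a rel \<Rightarrow> bool" where
  "is_card_sup K \<kappa> \<longleftrightarrow> (\<forall>n. K n \<le>o \<kappa>) \<and>
     (\<forall>\<mu>::'a rel. Card_order \<mu> \<and> (\<forall>n. K n \<le>o \<mu>) \<longrightarrow> \<kappa> \<le>o \<mu>)"


section \<open>Perfect trees\<close>

text \<open>Finite sequences are lists; initial segments are given by \<^const>\<open>prefix\<close>.\<close>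

definition nodes :: "(nat \<Rightarrow> 'a rel) \<Rightarrow> 'a list set" where
  "nodes K = {t. \<forall>i < length t. t ! i \<in> Field (K i)}"

definition full_branches :: "(nat \<Rightarrow> 'a rel) \<Rightarrow> (nat \<Rightarrow> 'a) set" where
  "full_branches K = {f. \<forall>i. f i \<in> Field (K i)}"

definition restr :: "(nat \<Rightarrow> 'a) \<Rightarrow> nat \<Rightarrow> 'a list" where
  "restr f n = map f [0..<n]"

definition is_tree :: "(nat \<Rightarrow> 'a rel) \<Rightarrow> 'a list set \<Rightarrow> bool" where
  "is_tree K T \<longleftrightarrow> T \<subseteq> nodes K \<and> (\<forall>t\<in>T. \<forall>s. prefix s t \<longrightarrow> s \<in> T)"

definition branches :: "(nat \<Rightarrow> 'a rel) \<Rightarrow> 'a list set \<Rightarrow> (nat \<Rightarrow> 'a) set" where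
  "branches K T = {f \<in> full_branches K. \<forall>n. restr f n \<in> T}"

definition Succs :: "'a list set \<Rightarrow> 'a list \<Rightarrow> 'a list set" where
  "Succs T t = {s \<in> T. \<exists>x. s = t @ [x]}"

definition perfect_tree :: "(nat \<Rightarrow> 'a rel) \<Rightarrow> 'a list set \<Rightarrow> bool" where
  "perfect_tree K T \<longleftrightarrow> is_tree K T \<and> T \<noteq> {} \<and>
     (\<forall>t\<in>T. \<exists>f \<in> branches K T. restr f (length t) = t) \<and>
     (\<forall>n. \<forall>t\<in>T. \<exists>t'\<in>T. prefix t t' \<and> K n \<le>o |Succs T t'| )"

definition perfect_forcing :: "(nat \<Rightarrow> 'a rel) \<Rightarrow> 'a list set gorder" where
  "perfect_forcing K = \<lparr>carrier = {T. perfect_tree K T}, eq = (=), le = (\<subseteq>)\<rparr>"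


section \<open>Regular open completion of a poset\<close>

definition downset_topology :: "'a gorder \<Rightarrow> 'a topology" where
  "downset_topology P = topology (\<lambda>U. U \<subseteq> carrier P \<and>
     (\<forall>p\<in>U. \<forall>q\<in>carrier P. le P q p \<longrightarrow> q \<in> U))"

lemma openin_downset_topology:
  "openin (downset_topology P) U \<longleftrightarrow> U \<subseteq> carrier P \<and>
     (\<forall>p\<in>U. \<forall>q\<in>carrier P. le P q p \<longrightarrow> q \<in> U)"
proof -
  have "istopology (\<lambda>U. U \<subseteq> carrier P \<and> (\<forall>p\<in>U. \<forall>q\<in>carrier P. le P q p \<longrightarrow> q \<in> U))"
    unfolding istopology_def by blast
  then show ?thesis
    by (simp add: downset_topology_def topology_inverse')
qed

lemma topspace_downset_topology [simp]: "topspace (downset_topology P) = carrier P"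
proof -
  have "openin (downset_topology P) (carrier P)"
    by (simp add: openin_downset_topology)
  then show ?thesis
    by (metis openin_downset_topology openin_subset openin_topspace subset_antisym)
qed

definition regular_open_completion :: "'a gorder \<Rightarrow> 'a set gorder" where
  "regular_open_completion P =
     \<lparr>carrier = {U. U = downset_topology P interior_of (downset_topology P closure_of U)},
      eq = (=), le = (\<subseteq>)\<rparr>"


section \<open>The Boolean algebra of subsets of the naturals modulo finite sets\<close>

definition fin_diff :: "nat set rel" where
  "fin_diff = {(A, B). finite (A - B) \<and> finite (B - A)}"

definition power_mod_fin :: "nat set set gorder" where
  "power_mod_fin = \<lparr>carrier = UNIV // fin_diff, eq = (=),
     le = (\<lambda>X Y. \<exists>A\<in>X. \<exists>B\<in>Y. finite (A - B))\<rparr>"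

lemma equiv_fin_diff: "equiv UNIV fin_diff"
proof (rule equivI)
  show "trans fin_diff"
  proof (rule transI)
    fix A B C assume "(A, B) \<in> fin_diff" "(B, C) \<in> fin_diff"
    then have "finite ((A - B) \<union> (B - C))" "finite ((C - B) \<union> (B - A))"
      by (auto simp: fin_diff_def)
    moreover have "A - C \<subseteq> (A - B) \<union> (B - C)" "C - A \<subseteq> (C - B) \<union> (B - A)" by auto
    ultimately show "(A, C) \<in> fin_diff"
      by (auto simp: fin_diff_def intro: finite_subset)
  qed
qed (auto simp: fin_diff_def refl_on_def sym_def)

lemma le_power_mod_fin:
  "le power_mod_fin (fin_diff `` {A}) (fin_diff `` {B}) \<longleftrightarrow> finite (A - B)"
proof
  assume "le power_mod_fin (fin_diff `` {A}) (fin_diff `` {B})"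
  then obtain A' B' where "finite ((A - A') \<union> (A' - B') \<union> (B' - B))"
    by (auto simp: power_mod_fin_def fin_diff_def)
  then show "finite (A - B)" by (rule rev_finite_subset) auto
next
  assume "finite (A - B)"
  moreover have "A \<in> fin_diff `` {A}" "B \<in> fin_diff `` {B}" by (auto simp: fin_diff_def)
  ultimately show "le power_mod_fin (fin_diff `` {A}) (fin_diff `` {B})"
    unfolding power_mod_fin_def by auto
qed


section \<open>Complete embeddings\<close>

text \<open>The zero element is \<^const>\<open>bottom\<close>; the lemmas at the end identify it in the two
  algebras defined above.\<close>

definition nonzero :: "'a gorder \<Rightarrow> 'a set" where
  "nonzero L = carrier L - {bottom L}"

definition compatible :: "'a gorder \<Rightarrow> 'a \<Rightarrow> 'a \<Rightarrow> bool" where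
  "compatible L a b \<longleftrightarrow> (\<exists>c \<in> nonzero L. le L c a \<and> le L c b)"

definition complete_embedding :: "'a gorder \<Rightarrow> 'b gorder \<Rightarrow> ('a \<Rightarrow> 'b) \<Rightarrow> bool" where
  "complete_embedding S T i \<longleftrightarrow> i \<in> carrier S \<rightarrow> carrier T \<and>
     (\<forall>s\<in>nonzero S. \<forall>s'\<in>nonzero S. le S s s' \<longrightarrow> le T (i s) (i s')) \<and>
     (\<forall>s\<in>carrier S. \<forall>s'\<in>carrier S. \<not> compatible S s s' \<longleftrightarrow> \<not> compatible T (i s) (i s')) \<and>
     (\<forall>t\<in>nonzero T. \<exists>s\<in>nonzero S. \<forall>s'\<in>nonzero S. le S s' s \<longrightarrow> compatible T (i s') t)"

lemma bottom_regular_open_completion: "bottom (regular_open_completion P) = {}"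
proof -
  have "least (regular_open_completion P) {} (carrier (regular_open_completion P))"
    by (auto simp: least_def regular_open_completion_def)
  moreover have "x = {}" if "least (regular_open_completion P) x (carrier (regular_open_completion P))" for x
    using that calculation by (auto simp: least_def regular_open_completion_def)
  ultimately show ?thesis
    unfolding bottom_def by (rule some_equality)
qed

lemma bottom_power_mod_fin: "bottom power_mod_fin = {A. finite A}"
proof -
  let ?L = power_mod_fin
  have z: "fin_diff `` {{}} = {A. finite A}" by (auto simp: fin_diff_def)
  have c: "carrier ?L = UNIV // fin_diff" by (simp add: power_mod_fin_def)
  have *: "least ?L {A. finite A} (carrier ?L)"
    unfolding least_def
  proof (intro conjI ballI)
    show "{A. finite A} \<in> carrier ?L" unfolding c z[symmetric] by (rule quotientI) simp
    fix X assume "X \<in> carrier ?L"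
    then obtain A where X: "X = fin_diff `` {A}" unfolding c by (rule quotientE)
    show "le ?L {A. finite A} X" unfolding X z[symmetric] le_power_mod_fin by simp
  qed simp
  moreover have "X = {A. finite A}" if l: "least ?L X (carrier ?L)" for X
  proof -
    have "X \<in> carrier ?L" using l by (simp add: least_def)
    then obtain A where X: "X = fin_diff `` {A}" unfolding c by (rule quotientE)
    have "le ?L X {A. finite A}" using l * by (auto simp: least_def)
    then have "finite A" unfolding X z[symmetric] le_power_mod_fin by simp
    then show ?thesis
      unfolding X by (auto simp: fin_diff_def intro: finite_subset[of _ "A \<union> (_ - A)"])
  qed
  ultimately show ?thesis
    unfolding bottom_def by (rule some_equality)
qed

end

theory Submission
  imports Defs
begin

text \<open>
  A class \<open>[A]\<close> goes to the regular open set generated by the perfect trees all of whose splitting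
  levels lie in some \<open>A' =\<^sup>* A\<close>. A perfect tree must split on infinitely many levels, so \<open>[A]\<close> and
  \<open>[B]\<close> have compatible images exactly if \<open>A \<inter> B\<close> is infinite.

  For the remaining clause of complete embeddings one has to find, inside a perfect tree \<open>T\<close>, a
  pruned tree and an infinite set \<open>D\<close> of levels on which all its nodes split, more and more as the
  level grows; it can then be thinned out to split only on a given infinite subset of \<open>D\<close>.
  For fixed \<open>D\<close>, consider the game in which the opponent discards, at the \<open>n\<close>-th level of \<open>D\<close>, fewer
  than \<open>\<kappa>\<^sub>n\<close> successors of the current node, and the player moves to another successor,
  losing when stuck. If the opponent does not win, the nodes which are not lost form the desired
  tree. If the opponent won for every \<open>D\<close>, fix winning strategies for all of them. Since there are
  only \<open>2\<^sup>\<omega> < \<kappa>\<^sub>0\<close> sets \<open>D\<close> (after discarding finitely many \<open>\<kappa>\<^sub>n\<close>) and the \<open>\<kappa>\<^sub>n\<close> are regular,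
  one can run through splitting nodes of \<open>T\<close> while evading the strategies for all \<open>D\<close> consistent
  with the levels used so far; the branch obtained beats the strategy for the set of levels
  that it used.
\<close>

section \<open>Branches and pruned trees\<close>

definition labels :: "'a list set \<Rightarrow> 'a list \<Rightarrow> 'a set" where
  "labels T s = {x. s @ [x] \<in> T}"

lemma card_of_Succs: "|Succs T s| =o |labels T s|"
proof -
  have "bij_betw (\<lambda>x. s @ [x]) (labels T s) (Succs T s)"
    by (auto simp: bij_betw_def inj_on_def labels_def Succs_def)
  then show ?thesis
    using card_of_ordIso ordIso_symmetric by blast
qed

lemma length_restr [simp]: "length (restr f n) = n"
  by (simp add: restr_def)

lemma take_restr: "k \<le> n \<Longrightarrow> take k (restr f n) = restr f k"
  by (simp add: restr_def take_map)

lemma nth_restr: "i < n \<Longrightarrow> restr f n ! i = f i"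
  by (simp add: restr_def)

lemma restr_Suc: "restr f (Suc n) = restr f n @ [f n]"
  by (simp add: restr_def)

text \<open>The lengths of the \<open>u n\<close> are unbounded, so the entries
  \<open>u (Suc l) ! l\<close> exist; by coherence of the chain they agree with the entry at
  \<open>l\<close> of every \<open>u n\<close> that has one.\<close>

lemma branch_of_chain:
  assumes T: "is_tree K T" and u: "\<And>n. u n \<in> T" "\<And>n. strict_prefix (u n) (u (Suc n))"
  obtains f where "f \<in> branches K T" "\<And>n. restr f (length (u n)) = u n"
proof -
  have mono: "prefix (u m) (u n)" if "m \<le> n" for m n
    using that by (induction n rule: dec_induct)
      (simp, meson u(2) prefix_order.less_imp_le prefix_order.trans)
  have len: "n \<le> length (u n)" for n
  proof (induction n)
    case (Suc n)
    then show ?case using prefix_length_less[OF u(2)[of n]] by linarith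
  qed simp
  define f where "f = (\<lambda>l. u (Suc l) ! l)"
  have f: "restr f (length (u n)) = u n" for n
  proof (rule nth_equalityI)
    fix i assume "i < length (restr f (length (u n)))"
    then have i: "i < length (u n)" by simp
    have i': "i < length (u (Suc i))" using len[of "Suc i"] by simp
    have "u (Suc i) ! i = u n ! i"
    proof (cases "n \<le> Suc i")
      case True
      then show ?thesis using mono[OF True] i by (auto simp: prefix_def nth_append)
    next
      case False
      then show ?thesis using mono[of "Suc i" n] i' by (auto simp: prefix_def nth_append)
    qed
    then show "restr f (length (u n)) ! i = u n ! i"
      using i by (simp add: nth_restr f_def)
  qed simp
  have inT: "restr f k \<in> T" for k
  proof -
    have "restr f k = take k (u k)"
      using take_restr[OF len, of k f] f[of k] by simp
    then show ?thesis
      using T u(1)[of k] take_is_prefix unfolding is_tree_def by metis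
  qed
  have "f i \<in> Field (K i)" for i
  proof -
    have "restr f (Suc i) \<in> nodes K" using inT T by (auto simp: is_tree_def)
    then show ?thesis by (auto simp: nodes_def nth_restr)
  qed
  then have "f \<in> branches K T"
    using inT by (auto simp: branches_def full_branches_def)
  then show ?thesis using f that by blast
qed

text \<open>Having no leaves suffices to run a branch through every node; how widely the nodes split
  is tracked separately.\<close>

definition pruned_tree :: "(nat \<Rightarrow> 'a rel) \<Rightarrow> 'a list set \<Rightarrow> bool" where
  "pruned_tree K T \<longleftrightarrow> is_tree K T \<and> [] \<in> T \<and> (\<forall>s\<in>T. labels T s \<noteq> {})"

lemma pruned_tree_branch:
  assumes T: "pruned_tree K T" and t: "t \<in> T"
  obtains f where "f \<in> branches K T" "restr f (length t) = t"
proof -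
  have "\<exists>u. \<forall>n. (u n \<in> T \<and> (n = 0 \<longrightarrow> u n = t)) \<and> strict_prefix (u n) (u (Suc n))"
  proof (rule dependent_nat_choice)
    show "\<exists>s. s \<in> T \<and> (0 = 0 \<longrightarrow> s = t)" using t by blast
    fix s and n :: nat assume "s \<in> T \<and> (n = 0 \<longrightarrow> s = t)"
    then obtain x where "s @ [x] \<in> T" using T by (auto simp: pruned_tree_def labels_def)
    then show "\<exists>s'. (s' \<in> T \<and> (Suc n = 0 \<longrightarrow> s' = t)) \<and> strict_prefix s s'"
      unfolding strict_prefix_def by (intro exI[of _ "s @ [x]"]) simp
  qed
  then obtain u where u: "u 0 = t" "\<And>n. u n \<in> T" "\<And>n. strict_prefix (u n) (u (Suc n))"
    by blast
  show ?thesis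
    using branch_of_chain[of K T u] u T that unfolding pruned_tree_def by metis
qed

lemma pruned_perfect_tree:
  assumes "perfect_tree K T"
  shows "pruned_tree K T"
proof -
  have "labels T s \<noteq> {}" if s: "s \<in> T" for s
  proof -
    obtain f where f: "f \<in> branches K T" "restr f (length s) = s"
      using assms s unfolding perfect_tree_def by blast
    then have "restr f (Suc (length s)) \<in> T" unfolding branches_def by blast
    then show ?thesis using f(2) by (auto simp: labels_def restr_Suc)
  qed
  then show ?thesis
    using assms by (auto simp: pruned_tree_def perfect_tree_def is_tree_def)
qed

section \<open>Thinning out a uniformly splitting tree\<close>

text \<open>The bound \<open>l0\<close> may depend on \<open>m\<close> but not on the node, so
  splitting stays large above every node even when only an infinite subset of \<open>D\<close> is
  kept.\<close>

definition splits_uniformly :: "(nat \<Rightarrow> 'a rel) \<Rightarrow> 'a list set \<Rightarrow> nat set \<Rightarrow> bool" where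
  "splits_uniformly K T D \<longleftrightarrow>
     (\<forall>m. \<exists>l0. \<forall>s\<in>T. length s \<in> D \<and> l0 \<le> length s \<longrightarrow> K m \<le>o |labels T s| )"

definition splits_only_in :: "nat set \<Rightarrow> 'a list set \<Rightarrow> bool" where
  "splits_only_in A T \<longleftrightarrow> (\<forall>s x y. s @ [x] \<in> T \<and> s @ [y] \<in> T \<and> x \<noteq> y \<longrightarrow> length s \<in> A)"

text \<open>All successors are kept at levels in \<open>J\<close> and a single one elsewhere.
  Branches of the thinned tree still pass every level of \<open>J\<close>, and far enough up the
  nodes there have as many successors as uniform splitting of \<open>T\<close> provides.\<close>

lemma restrict_split_levels:
  assumes T: "pruned_tree K T" and D: "splits_uniformly K T D"
    and J: "J \<subseteq> D" "infinite J"
  obtains S where "S \<subseteq> T" "perfect_tree K S" "splits_only_in J S"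
proof -
  define c where "c s = (if length s \<in> J then labels T s else {SOME x. x \<in> labels T s})" for s
  define S where "S = {s. \<forall>i<length s. s ! i \<in> c (take i s)}"
  have nil: "[] \<in> S" by (simp add: S_def)
  have mem_snoc: "s @ [x] \<in> S \<longleftrightarrow> s \<in> S \<and> x \<in> c s" for s x
    by (auto simp: S_def nth_append less_Suc_eq)
  have cT: "c s \<subseteq> labels T s" "c s \<noteq> {}" if "s \<in> T" for s
  proof -
    have "labels T s \<noteq> {}" using that T by (simp add: pruned_tree_def)
    then show "c s \<subseteq> labels T s" "c s \<noteq> {}"
      by (auto simp: c_def intro: someI)
  qed
  have ST: "s \<in> T" if "s \<in> S" for s
    using that
  proof (induction s rule: rev_induct)
    case Nil
    then show ?case using T by (simp add: pruned_tree_def)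
  next
    case (snoc x s)
    then have "s \<in> T" "x \<in> c s" using mem_snoc by auto
    then show ?case using cT(1) by (auto simp: labels_def)
  qed
  have closed: "s \<in> S" if st: "prefix s t" "t \<in> S" for s t
  proof -
    obtain r where "t = s @ r" using st(1) unfolding prefix_def by blast
    then show ?thesis using st(2)
    proof (induction r arbitrary: t rule: rev_induct)
      case (snoc x r)
      then show ?case using mem_snoc append_assoc by metis
    qed simp
  qed
  have labS: "labels S s = c s" if "s \<in> S" for s
    using that by (auto simp: labels_def mem_snoc)
  have tree: "is_tree K S"
    using ST closed T by (auto simp: is_tree_def pruned_tree_def)
  then have pr: "pruned_tree K S"
    using nil labS cT(2) ST by (auto simp: pruned_tree_def)
  have split: "\<exists>t'\<in>S. prefix t t' \<and> K n \<le>o |Succs S t'|" if t: "t \<in> S" for n t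
  proof -
    obtain f where f: "f \<in> branches K S" "restr f (length t) = t"
      using pruned_tree_branch[OF pr t] .
    obtain l0 where l0: "\<And>s. s \<in> T \<Longrightarrow> length s \<in> D \<Longrightarrow> l0 \<le> length s \<Longrightarrow> K n \<le>o |labels T s|"
      using D unfolding splits_uniformly_def by blast
    obtain l where l: "l \<in> J" "max l0 (length t) < l"
      using J(2) by (meson infinite_nat_iff_unbounded)
    define t' where "t' = restr f l"
    have t': "t' \<in> S" using f(1) by (auto simp: branches_def t'_def)
    have "t = take (length t) t'" using take_restr[of "length t" l f] f(2) l(2) by (simp add: t'_def)
    then have "prefix t t'" by (metis take_is_prefix)
    moreover have "labels S t' = labels T t'"
      using labS[OF t'] l(1) by (simp add: c_def t'_def)
    then have "K n \<le>o |labels S t'|"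
      using l0[OF ST[OF t']] l J(1) by (auto simp: t'_def)
    then have "K n \<le>o |Succs S t'|"
      using card_of_Succs ordIso_symmetric ordLeq_ordIso_trans by blast
    ultimately show ?thesis using t' by blast
  qed
  have "perfect_tree K S"
    unfolding perfect_tree_def using tree nil split pruned_tree_branch[OF pr] by (metis empty_iff)
  moreover have "splits_only_in J S"
    by (auto simp: splits_only_in_def mem_snoc c_def split: if_splits)
  ultimately show ?thesis using that ST by blast
qed

lemma Cinfinite_of_natLeq_ordLess:
  assumes "Card_order r" "natLeq <o r"
  shows "Cinfinite r"
  using assms(1) cinfinite_mono[OF ordLess_imp_ordLeq[OF assms(2)] natLeq_cinfinite] by simp

section \<open>The splitting game\<close>

text \<open>The \<open>n\<close>-th level of \<open>D\<close> is the \<open>l \<in> D\<close> with \<open>card (D \<inter> {..<l}) = n\<close>.\<close>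

definition sparse :: "(nat \<Rightarrow> 'a rel) \<Rightarrow> nat set \<Rightarrow> 'a list \<Rightarrow> 'a set \<Rightarrow> bool" where
  "sparse M D s E \<longleftrightarrow> (if length s \<in> D then |E| <o M (card (D \<inter> {..<length s})) else E = {})"

lemma sparse_empty:
  assumes "\<And>n. natLeq <o M n"
  shows "sparse M D s {}"
proof -
  have "|{}::'a set| \<le>o natLeq" using card_of_empty1 natLeq_Well_order by blast
  then show ?thesis
    using assms ordLeq_ordLess_trans unfolding sparse_def by auto
qed

text \<open>Being inductive, this captures a win of the opponent in which every play ends with the
  player stuck; infinite plays count for the player. The base case is a legal \<open>E\<close>
  containing all successor labels.\<close>

inductive losing :: "(nat \<Rightarrow> 'a rel) \<Rightarrow> nat set \<Rightarrow> 'a list set \<Rightarrow> 'a list \<Rightarrow> bool"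
  for M D T where
  step: "sparse M D s E \<Longrightarrow> (\<And>x. x \<notin> E \<Longrightarrow> s @ [x] \<in> T \<Longrightarrow> losing M D T (s @ [x])) \<Longrightarrow> losing M D T s"

text \<open>If the non-losing successors of a non-losing node formed a legal move, discarding them
  would leave only losing ones and make the node losing. Hence there is always one, and at the
  \<open>n\<close>-th level of \<open>D\<close> there are at least \<open>M n\<close>.\<close>

lemma uniform_subtree_of_not_losing:
  assumes T: "is_tree K T" "[] \<in> T" and nl: "\<not> losing M D T []" and inf: "infinite D"
    and M: "\<And>n. Card_order (M n)" "\<And>n. natLeq <o M n" "\<And>m. \<exists>n0. \<forall>n\<ge>n0. K m \<le>o M n"
  obtains S where "S \<subseteq> T" "pruned_tree K S" "splits_uniformly K S D"
proof -
  define S where "S = {s \<in> T. \<forall>r. prefix r s \<longrightarrow> \<not> losing M D T r}"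
  have lab: "labels S s = {x. s @ [x] \<in> T \<and> \<not> losing M D T (s @ [x])}" if "s \<in> S" for s
    using that by (auto simp: S_def labels_def)
  have notsparse: "\<not> sparse M D s (labels S s)" if s: "s \<in> S" for s
  proof
    assume "sparse M D s (labels S s)"
    then have "losing M D T s" by (rule losing.step) (use lab[OF s] in auto)
    then show False using s by (auto simp: S_def)
  qed
  have "labels S s \<noteq> {}" if "s \<in> S" for s
    using notsparse[OF that] sparse_empty[of M, OF M(2)] by metis
  moreover have "is_tree K S"
    using T by (auto simp: S_def is_tree_def intro: prefix_order.trans)
  moreover have "[] \<in> S" using T nl by (auto simp: S_def)
  ultimately have "pruned_tree K S" by (auto simp: pruned_tree_def)
  moreover have "splits_uniformly K S D"
    unfolding splits_uniformly_def
  proof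
    fix m
    obtain n0 where n0: "\<And>n. n \<ge> n0 \<Longrightarrow> K m \<le>o M n" using M(3) by blast
    \<comment> \<open>Above \<open>n0\<close> elements of \<open>D\<close>, the index of a level
      within \<open>D\<close> is at least \<open>n0\<close>, whatever the node.\<close>
    obtain F where F: "F \<subseteq> D" "finite F" "card F = n0"
      using inf infinite_arbitrarily_large by blast
    obtain l0 where l0: "F \<subseteq> {..<l0}" using F(2) finite_nat_iff_bounded by blast
    show "\<exists>l0. \<forall>s\<in>S. length s \<in> D \<and> l0 \<le> length s \<longrightarrow> K m \<le>o |labels S s|"
    proof (intro exI[of _ l0] ballI impI)
      fix s assume s: "s \<in> S" "length s \<in> D \<and> l0 \<le> length s"
      let ?n = "card (D \<inter> {..<length s})"
      have "F \<subseteq> D \<inter> {..<length s}" using F(1) l0 s(2) by auto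
      then have "n0 \<le> ?n" using card_mono[of "D \<inter> {..<length s}" F] F(3) by auto
      then have "K m \<le>o M ?n" by (rule n0)
      moreover have "\<not> |labels S s| <o M ?n" using notsparse[OF s(1)] s(2) by (simp add: sparse_def)
      then have "M ?n \<le>o |labels S s|"
        using M(1) card_of_Well_order card_order_on_well_order_on not_ordLess_iff_ordLeq by blast
      ultimately show "K m \<le>o |labels S s|" using ordLeq_transitive by blast
    qed
  qed
  moreover have "S \<subseteq> T" by (auto simp: S_def)
  ultimately show ?thesis using that by blast
qed

text \<open>The strategies below the successors of \<open>s\<close> live on disjoint cones, so they can be glued.\<close>

lemma strategy_of_losing:
  assumes "losing M D T s" and M: "\<And>n. natLeq <o M n"
  shows "\<exists>E. (\<forall>u. sparse M D u (E u)) \<and>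
    \<not> (\<exists>f. (\<forall>n. restr f n \<in> T) \<and> restr f (length s) = s \<and> (\<forall>l\<ge>length s. f l \<notin> E (restr f l)))"
  using assms(1)
proof induction
  case (step s E0)
  let ?P = "\<lambda>s E. (\<forall>u. sparse M D u (E u)) \<and>
    \<not> (\<exists>f. (\<forall>n. restr f n \<in> T) \<and> restr f (length s) = s \<and> (\<forall>l\<ge>length s. f l \<notin> E (restr f l)))"
  have "\<forall>x. \<exists>E. x \<notin> E0 \<and> s @ [x] \<in> T \<longrightarrow> ?P (s @ [x]) E" using step.IH by blast
  then obtain F where F: "\<And>x. x \<notin> E0 \<Longrightarrow> s @ [x] \<in> T \<Longrightarrow> ?P (s @ [x]) (F x)"
    by metis
  \<comment> \<open>Outside the cones of the surviving successors the empty set serves as default: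
    it is a legal move everywhere.\<close>
  define E where "E u = (if u = s then E0 else
     let x = u ! length s in if length s < length u \<and> x \<notin> E0 \<and> s @ [x] \<in> T then F x u else {})" for u
  have sp: "sparse M D u (E u)" for u
  proof -
    have "sparse M D u {}" using M by (rule sparse_empty)
    then show ?thesis using step.hyps(1) F by (auto simp: E_def Let_def)
  qed
  have False if f: "\<forall>n. restr f n \<in> T" "restr f (length s) = s" "\<forall>l\<ge>length s. f l \<notin> E (restr f l)" for f
  proof -
    let ?x = "f (length s)"
    have "?x \<notin> E0" using f(2) f(3)[rule_format, of "length s"] by (simp add: E_def)
    moreover have sx: "restr f (Suc (length s)) = s @ [?x]" using f(2) by (simp add: restr_Suc)
    then have "s @ [?x] \<in> T" using f(1) by metis
    moreover have "f l \<notin> F ?x (restr f l)" if l: "l \<ge> length (s @ [?x])" for l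
    proof -
      \<comment> \<open>Beyond \<open>s\<close> the branch stays in the cone of
        \<open>s @ [?x]\<close>, where \<open>E\<close> follows \<open>F ?x\<close>.\<close>
      have "restr f l \<noteq> s" using l by (metis length_append_singleton length_restr not_less_eq_eq order_refl)
      then have "E (restr f l) = F ?x (restr f l)"
        using l calculation by (auto simp: E_def nth_restr)
      moreover have "f l \<notin> E (restr f l)" using f(3) l by simp
      ultimately show ?thesis by simp
    qed
    moreover have "restr f (length (s @ [?x])) = s @ [?x]" using sx by simp
    ultimately show False using F[of ?x] f(1) by blast
  qed
  then show ?case using sp by blast
qed

text \<open>The branch is built before the set of its splitting levels is known: at each stage it
  evades all strategies for which the current level could be the right one. Its own set of levels is
  then among those evaded.\<close>

lemma exists_not_losing:
  assumes T: "perfect_tree K T"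
    and M: "\<And>n. Card_order (M n)" "\<And>n. regularCard (M n)" "\<And>n. natLeq <o M n"
      "\<And>n. |UNIV :: nat set set| <o M n" "\<And>n. \<exists>m. M n \<le>o K m"
  obtains D where "infinite D" "\<not> losing M D T []"
proof (rule ccontr)
  assume "\<not> thesis"
  then have "\<forall>D. \<exists>E. infinite D \<longrightarrow> (\<forall>u. sparse M D u (E u)) \<and>
    \<not> (\<exists>f. (\<forall>n. restr f n \<in> T) \<and> (\<forall>l. f l \<notin> E (restr f l)))"
    using strategy_of_losing[of M _ T "[]", OF _ M(3)] that
    by (simp add: restr_def) blast
  then obtain E where E: "\<And>D u. infinite D \<Longrightarrow> sparse M D u (E D u)"
      "\<And>D f. infinite D \<Longrightarrow> \<forall>n. restr f n \<in> T \<Longrightarrow> \<exists>l. f l \<in> E D (restr f l)"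
    by metis
  \<comment> \<open>At stage \<open>n\<close> in node \<open>u\<close>, only sets \<open>D\<close>
    having \<open>length u\<close> as their \<open>n\<close>-th level can still arise;
    \<open>B n u\<close> gathers what their strategies forbid.\<close>
  define B where "B n u = (\<Union>D \<in> {D. infinite D \<and> length u \<in> D \<and> card (D \<inter> {..<length u}) = n}. E D u)"
    for n u
  \<comment> \<open>Regularity of \<open>M n\<close>: at most continuum many, hence fewer than
    \<open>M n\<close>, sets are united, each smaller than \<open>M n\<close>.\<close>
  have B: "|B n u| <o M n" for n u
  proof -
    have C: "Cinfinite (M n)" by (rule Cinfinite_of_natLeq_ordLess[OF M(1,3)])
    show ?thesis
      unfolding B_def
    proof (rule card_of_UNION_ordLess_infinite_Field_regularCard[OF M(2) C])
      show "|{D. infinite D \<and> length u \<in> D \<and> card (D \<inter> {..<length u}) = n}| <o M n"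
        by (rule ordLeq_ordLess_trans[OF card_of_mono1[OF subset_UNIV] M(4)])
      show "\<forall>D\<in>{D. infinite D \<and> length u \<in> D \<and> card (D \<inter> {..<length u}) = n}. |E D u| <o M n"
        using E(1)[of _ u] by (auto simp: sparse_def)
    qed
  qed
  have tree: "is_tree K T" "[] \<in> T"
    using pruned_perfect_tree[OF T] by (auto simp: pruned_tree_def)
  have ext: "\<exists>u\<in>T. prefix t u \<and> M n \<le>o |labels T u|" if "t \<in> T" for t n
  proof -
    obtain m where m: "M n \<le>o K m" using M(5) by blast
    obtain u where "u \<in> T" "prefix t u" "K m \<le>o |Succs T u|"
      using T \<open>t \<in> T\<close> unfolding perfect_tree_def by blast
    then show ?thesis using m card_of_Succs ordLeq_ordIso_trans ordLeq_transitive by metis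
  qed
  \<comment> \<open>Only the label \<open>x\<close> taken right after \<open>u n\<close> must avoid
    forbidden labels. The way from there to the next node with many successors is unrestricted,
    since its levels will not belong to the final set.\<close>
  have "\<exists>u. \<forall>n. (u n \<in> T \<and> M n \<le>o |labels T (u n)| ) \<and>
     (\<exists>x. x \<notin> B n (u n) \<and> prefix (u n @ [x]) (u (Suc n)))"
  proof (rule dependent_nat_choice)
    show "\<exists>u. u \<in> T \<and> M 0 \<le>o |labels T u|" using ext tree(2) by blast
    fix u n assume u: "u \<in> T \<and> M n \<le>o |labels T u|"
    have "\<not> labels T u \<subseteq> B n u"
    proof
      assume "labels T u \<subseteq> B n u"
      then have "M n \<le>o |B n u|" using u card_of_mono1 ordLeq_transitive by blast
      then show False using B not_ordLess_ordLeq by blast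
    qed
    then obtain x where "u @ [x] \<in> T" "x \<notin> B n u" by (auto simp: labels_def)
    then show "\<exists>v. (v \<in> T \<and> M (Suc n) \<le>o |labels T v| ) \<and> (\<exists>x. x \<notin> B n u \<and> prefix (u @ [x]) v)"
      using ext by metis
  qed
  then obtain u x where u: "\<And>n. u n \<in> T" "\<And>n. x n \<notin> B n (u n)" "\<And>n. prefix (u n @ [x n]) (u (Suc n))"
    by metis
  have sp: "strict_prefix (u n) (u (Suc n))" for n
    using u(3)[of n] by (metis prefix_snocD)
  obtain f where f: "f \<in> branches K T" "\<And>n. restr f (length (u n)) = u n"
    using branch_of_chain[OF tree(1), of u] u(1) sp by blast
  define l where "l n = length (u n)" for n
  have l: "strict_mono l"
    unfolding strict_mono_Suc_iff l_def using sp prefix_length_less by blast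
  have fx: "f (l n) = x n" for n
  proof -
    have "l n < length (u (Suc n))" using l by (simp add: l_def strict_mono_Suc_iff)
    then have "f (l n) = u (Suc n) ! l n" using f(2)[of "Suc n"] nth_restr by metis
    also have "\<dots> = x n" using u(3)[of n] by (auto simp: prefix_def l_def)
    finally show ?thesis .
  qed
  have inf: "infinite (range l)"
    using l range_inj_infinite strict_mono_imp_inj_on by blast
  then obtain k where k: "f k \<in> E (range l) (restr f k)"
    using E(2)[of "range l" f] f(1) by (auto simp: branches_def)
  \<comment> \<open>Off \<open>range l\<close> the strategy for \<open>range l\<close> forbids
    nothing, so the branch can only be caught at some \<open>l n\<close>.\<close>
  have "k \<in> range l" using k E(1)[OF inf, of "restr f k"] by (auto simp: sparse_def split: if_splits)
  then obtain n where n: "k = l n" by blast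
  have "range l \<inter> {..<l n} = l ` {..<n}"
    using l by (auto simp: strict_mono_less)
  then have "card (range l \<inter> {..<l n}) = n"
    using l by (simp add: card_image strict_mono_imp_inj_on inj_on_subset)
  moreover have "x n \<in> E (range l) (u n)"
  proof -
    have "restr f (l n) = u n" using f(2) by (simp add: l_def)
    then show ?thesis using k unfolding n fx by simp
  qed
  ultimately have "x n \<in> B n (u n)" using inf by (auto simp: B_def l_def)
  then show False using u(2) by blast
qed


section \<open>Perfect trees with prescribed splitting levels\<close>

lemma ordLeq_of_increasing:
  assumes "\<And>n::nat. Card_order (K n)" "\<And>m n. m < n \<Longrightarrow> K m <o K n" "m \<le> n"
  shows "K m \<le>o K n"
  using assms
  by (metis le_neq_implies_less ordLess_imp_ordLeq card_order_on_well_order_on ordLeq_reflexive)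

lemma exists_uniform_levels:
  assumes T: "perfect_tree K T"
    and K: "\<And>n. Card_order (K n)" "\<And>n. regularCard (K n)" "\<And>n. natLeq <o K n"
      "\<And>m n. m < n \<Longrightarrow> K m <o K n" "|UNIV :: nat set set| <o K n0"
  obtains D where "infinite D"
    "\<And>J. J \<subseteq> D \<Longrightarrow> infinite J \<Longrightarrow> \<exists>S. S \<subseteq> T \<and> perfect_tree K S \<and> splits_only_in J S"
proof -
  \<comment> \<open>Dropping the first \<open>n0\<close> cardinals puts all of them above the
    continuum, and the tail still eventually dominates every \<open>K m\<close>.\<close>
  define M where "M n = K (n0 + n)" for n
  have mono: "K m \<le>o K n" if "m \<le> n" for m n
    using ordLeq_of_increasing[of K m n] K(1,4) that by blast
  have M: "Card_order (M n)" "regularCard (M n)" "natLeq <o M n" "|UNIV :: nat set set| <o M n"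
    "\<exists>m. M n \<le>o K m" for n
    using K(1,2,3) ordLess_ordLeq_trans[OF K(5) mono[of n0 "n0 + n"]] mono[of "n0 + n" "n0 + n"]
    by (auto simp: M_def)
  obtain D where D: "infinite D" "\<not> losing M D T []"
    using exists_not_losing[of K T M] T M by blast
  have "is_tree K T" "[] \<in> T"
    using pruned_perfect_tree[OF T] by (auto simp: pruned_tree_def)
  moreover have "\<exists>n1. \<forall>n\<ge>n1. K m \<le>o M n" for m
    unfolding M_def by (intro exI[of _ m] allI impI mono) simp
  ultimately obtain S where S: "S \<subseteq> T" "pruned_tree K S" "splits_uniformly K S D"
    using uniform_subtree_of_not_losing[of K T M D] D M(1,3) by blast
  show ?thesis
  proof (rule that[OF D(1)])
    fix J assume J: "J \<subseteq> D" "infinite J"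
    obtain R where "R \<subseteq> S" "perfect_tree K R" "splits_only_in J R"
      using restrict_split_levels[OF S(2,3) J] .
    then show "\<exists>S. S \<subseteq> T \<and> perfect_tree K S \<and> splits_only_in J S"
      using S(1) by (intro exI[of _ R]) auto
  qed
qed

text \<open>The full tree \<open>nodes K\<close> splits uniformly on all levels, as a node of length
  \<open>l\<close> has \<open>K l\<close> many successors; it is thinned out to
  \<open>J\<close>.\<close>

lemma exists_tree_splitting_only_in:
  assumes K: "\<And>n. Card_order (K n)" "\<And>n. natLeq <o K n" "\<And>m n. m < n \<Longrightarrow> K m <o K n"
    and J: "infinite J"
  obtains S where "perfect_tree K S" "splits_only_in J S"
proof -
  have mono: "K m \<le>o K n" if "m \<le> n" for m n
    using ordLeq_of_increasing[of K m n] K(1,3) that by blast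
  have nonempty: "Field (K n) \<noteq> {}" for n
  proof
    assume "Field (K n) = {}"
    then show False using Cinfinite_of_natLeq_ordLess[OF K(1,2), of n] by (simp add: cinfinite_def)
  qed
  have lab: "labels (nodes K) s = Field (K (length s))" if "s \<in> nodes K" for s
    using that by (auto simp: labels_def nodes_def nth_append less_Suc_eq)
  have "s \<in> nodes K" if st: "prefix s t" "t \<in> nodes K" for s t
  proof -
    obtain r where r: "t = s @ r" using st(1) unfolding prefix_def by blast
    have "s ! i \<in> Field (K i)" if "i < length s" for i
    proof -
      have "t ! i \<in> Field (K i)" using st(2) that r by (simp add: nodes_def)
      then show ?thesis using that r by (simp add: nth_append)
    qed
    then show ?thesis by (simp add: nodes_def)
  qed
  then have "pruned_tree K (nodes K)"
    using nonempty lab by (auto simp: pruned_tree_def is_tree_def nodes_def)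
  moreover have "splits_uniformly K (nodes K) UNIV"
    unfolding splits_uniformly_def
  proof
    fix m
    have "K m \<le>o |labels (nodes K) s|" if "s \<in> nodes K" "m \<le> length s" for s
      using mono[OF that(2)] lab[OF that(1)] card_of_Field_ordIso[OF K(1)]
      by (metis ordIso_symmetric ordLeq_ordIso_trans)
    then show "\<exists>l0. \<forall>s\<in>nodes K. length s \<in> UNIV \<and> l0 \<le> length s \<longrightarrow> K m \<le>o |labels (nodes K) s|"
      by blast
  qed
  ultimately show ?thesis
    using restrict_split_levels[of K "nodes K" UNIV J] J that by blast
qed

text \<open>Above any level \<open>b\<close> a perfect tree has a node with at least
  \<open>K 0\<close>, hence infinitely many, successors, and its level lies in
  \<open>A\<close>.\<close>

lemma infinite_split_levels:
  assumes T: "perfect_tree K T" "splits_only_in A T" and K: "\<And>n. natLeq <o K n"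
  shows "infinite A"
proof
  assume "finite A"
  then obtain b where b: "A \<subseteq> {..<b}" using finite_nat_iff_bounded by blast
  obtain f where f: "f \<in> branches K T"
    using T(1) unfolding perfect_tree_def by blast
  then obtain t where t: "t \<in> T" "prefix (restr f b) t" "K 0 \<le>o |Succs T t|"
    using T(1) unfolding perfect_tree_def branches_def by blast
  have "natLeq \<le>o |labels T t|"
    using K t(3) card_of_Succs ordLess_imp_ordLeq ordLeq_ordIso_trans ordLeq_transitive by metis
  then have inf: "infinite (labels T t)" using infinite_iff_natLeq_ordLeq by blast
  then obtain x where x: "x \<in> labels T t" by (metis all_not_in_conv finite.emptyI)
  have "\<not> labels T t \<subseteq> {x}" using inf finite_subset by blast
  then obtain y where "y \<in> labels T t" "y \<noteq> x" by blast
  then have "length t \<in> A" using T(2) x unfolding splits_only_in_def labels_def by blast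
  then show False using b prefix_length_le[OF t(2)] by auto
qed

section \<open>Regular open sets of perfect trees\<close>

text \<open>These are the trees below which \<open>U\<close> is dense. This is the regularization of
  \<open>U\<close>, so regular open sets are exactly its fixed points.\<close>

definition forced :: "(nat \<Rightarrow> 'a rel) \<Rightarrow> 'a list set set \<Rightarrow> 'a list set set" where
  "forced K U = {T. perfect_tree K T \<and>
     (\<forall>S. perfect_tree K S \<and> S \<subseteq> T \<longrightarrow> (\<exists>R\<in>U. perfect_tree K R \<and> R \<subseteq> S))}"

lemma interior_closure_eq_forced:
  "downset_topology (perfect_forcing K) interior_of (downset_topology (perfect_forcing K) closure_of U)
    = forced K U"
proof -
  let ?X = "downset_topology (perfect_forcing K)"
  \<comment> \<open>The cone below \<open>T\<close> is the least open neighbourhood of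
    \<open>T\<close>, so closure and interior can be tested on cones alone.\<close>
  have opn: "openin ?X {R. perfect_tree K R \<and> R \<subseteq> T}" for T
    by (auto simp: openin_downset_topology perfect_forcing_def)
  have cl: "?X closure_of U = {T. perfect_tree K T \<and> (\<exists>R\<in>U. perfect_tree K R \<and> R \<subseteq> T)}"
    (is "_ = ?C")
  proof (rule Set.set_eqI)
    fix T
    have "T \<in> ?C" if "T \<in> ?X closure_of U"
    proof -
      have "perfect_tree K T" using that by (simp add: in_closure_of perfect_forcing_def)
      then show ?thesis
        using that opn[of T] unfolding in_closure_of
        by (metis (mono_tags, lifting) mem_Collect_eq order_refl)
    qed
    moreover have "T \<in> ?X closure_of U" if "T \<in> ?C"
      using that by (auto simp: in_closure_of openin_downset_topology perfect_forcing_def)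
    ultimately show "T \<in> ?X closure_of U \<longleftrightarrow> T \<in> ?C" by blast
  qed
  show ?thesis
  proof (rule Set.set_eqI)
    fix T
    have "T \<in> forced K U" if int: "T \<in> ?X interior_of ?C"
    proof -
      obtain V where V: "openin ?X V" "T \<in> V" "V \<subseteq> ?C" using int unfolding interior_of_def by blast
      then have "S \<in> V" if "perfect_tree K S" "S \<subseteq> T" for S
        using that by (auto simp: openin_downset_topology perfect_forcing_def)
      then show ?thesis using V unfolding forced_def by blast
    qed
    moreover have "T \<in> ?X interior_of ?C" if "T \<in> forced K U"
    proof -
      have "{R. perfect_tree K R \<and> R \<subseteq> T} \<subseteq> ?C" "perfect_tree K T"
        using that unfolding forced_def by blast+
      then show ?thesis unfolding interior_of_def using opn[of T] by blast
    qed
    ultimately show "T \<in> ?X interior_of (?X closure_of U) \<longleftrightarrow> T \<in> forced K U"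
      unfolding cl by blast
  qed
qed

lemma carrier_completion:
  "U \<in> carrier (regular_open_completion (perfect_forcing K)) \<longleftrightarrow> U = forced K U"
  by (simp add: regular_open_completion_def interior_closure_eq_forced)

lemma le_completion: "le (regular_open_completion P) U V \<longleftrightarrow> U \<subseteq> V"
  by (simp add: regular_open_completion_def)

lemma forced_mono: "U \<subseteq> V \<Longrightarrow> forced K U \<subseteq> forced K V"
  unfolding forced_def by blast

lemma forced_down: "T \<in> forced K U \<Longrightarrow> perfect_tree K S \<Longrightarrow> S \<subseteq> T \<Longrightarrow> S \<in> forced K U"
  unfolding forced_def by blast

lemma forced_forced: "forced K (forced K U) = forced K U"
  unfolding forced_def by blast

text \<open>The regular open set generated by the cone below \<open>T\<close> is a nonzero common
  lower bound.\<close>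

lemma compatible_completion:
  assumes U: "U \<in> carrier (regular_open_completion (perfect_forcing K))"
    and V: "V \<in> carrier (regular_open_completion (perfect_forcing K))"
    and T: "perfect_tree K T" "T \<in> U" "T \<in> V"
  shows "compatible (regular_open_completion (perfect_forcing K)) U V"
proof -
  let ?W = "forced K {S. perfect_tree K S \<and> S \<subseteq> T}"
  have eq: "U = forced K U" "V = forced K V" using U V by (auto simp: carrier_completion)
  have "{S. perfect_tree K S \<and> S \<subseteq> T} \<subseteq> U" "{S. perfect_tree K S \<and> S \<subseteq> T} \<subseteq> V"
    using T eq forced_down[of T K U] forced_down[of T K V] by auto
  then have "?W \<subseteq> U" "?W \<subseteq> V" using eq forced_mono by metis+
  moreover have "?W \<noteq> {}" using T(1) unfolding forced_def by blast
  moreover have "?W \<in> carrier (regular_open_completion (perfect_forcing K))"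
    by (simp add: carrier_completion forced_forced)
  ultimately show ?thesis
    unfolding compatible_def nonzero_def bottom_regular_open_completion le_completion by blast
qed

section \<open>Subsets of the naturals modulo finite sets\<close>

lemma carrier_power_mod_finE:
  assumes "X \<in> carrier power_mod_fin"
  obtains A where "X = fin_diff `` {A}"
  using assms that unfolding power_mod_fin_def by (auto simp: quotient_def)

lemma nonzero_power_mod_fin: "fin_diff `` {A} \<in> nonzero power_mod_fin \<longleftrightarrow> infinite A"
proof -
  have "fin_diff `` {A} \<in> carrier power_mod_fin" by (simp add: power_mod_fin_def quotientI)
  moreover have "fin_diff `` {A} = {B. finite B} \<longleftrightarrow> finite A"
  proof
    have "A \<in> fin_diff `` {A}" by (simp add: fin_diff_def)
    then show "finite A" if "fin_diff `` {A} = {B. finite B}" using that by blast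
    assume A: "finite A"
    have "finite B" if "finite (B - A)" for B
      using A that finite_Diff2 by blast
    then show "fin_diff `` {A} = {B. finite B}"
      using A unfolding fin_diff_def by auto
  qed
  ultimately show ?thesis by (auto simp: nonzero_def bottom_power_mod_fin)
qed

lemma compatible_power_mod_fin:
  "compatible power_mod_fin (fin_diff `` {A}) (fin_diff `` {B}) \<longleftrightarrow> infinite (A \<inter> B)"
proof
  assume "compatible power_mod_fin (fin_diff `` {A}) (fin_diff `` {B})"
  then obtain X where X: "X \<in> nonzero power_mod_fin" "le power_mod_fin X (fin_diff `` {A})"
      "le power_mod_fin X (fin_diff `` {B})"
    by (auto simp: compatible_def)
  then obtain C where C: "X = fin_diff `` {C}" by (metis DiffD1 carrier_power_mod_finE nonzero_def)
  have "infinite C" "finite (C - A)" "finite (C - B)"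
    using X unfolding C le_power_mod_fin nonzero_power_mod_fin by auto
  moreover have "C \<subseteq> (A \<inter> B) \<union> ((C - A) \<union> (C - B))" by blast
  ultimately show "infinite (A \<inter> B)" by (meson finite_Un finite_subset)
next
  assume "infinite (A \<inter> B)"
  then show "compatible power_mod_fin (fin_diff `` {A}) (fin_diff `` {B})"
    unfolding compatible_def
    by (intro bexI[of _ "fin_diff `` {A \<inter> B}"])
      (auto simp: nonzero_power_mod_fin le_power_mod_fin Diff_eq_empty_iff[THEN iffD2])
qed

lemma splits_only_in_subset: "splits_only_in A T \<Longrightarrow> S \<subseteq> T \<Longrightarrow> splits_only_in A S"
  unfolding splits_only_in_def by blast

lemma splits_only_in_mono: "splits_only_in A T \<Longrightarrow> A \<subseteq> B \<Longrightarrow> splits_only_in B T"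
  unfolding splits_only_in_def by blast

lemma splits_only_in_Int: "splits_only_in A T \<Longrightarrow> splits_only_in B T \<Longrightarrow> splits_only_in (A \<inter> B) T"
  unfolding splits_only_in_def by blast

section \<open>The map from classes of level sets to regular open sets\<close>

text \<open>Allowing every member \<open>A\<close> of the class \<open>X\<close> avoids a choice of
  representatives.\<close>

definition level_embedding :: "(nat \<Rightarrow> 'a rel) \<Rightarrow> nat set set \<Rightarrow> 'a list set set" where
  "level_embedding K X = forced K {T. perfect_tree K T \<and> (\<exists>A\<in>X. splits_only_in A T)}"

lemma level_embedding_memI:
  assumes "perfect_tree K T" "A \<in> X" "splits_only_in A T"
  shows "T \<in> level_embedding K X"
proof -
  have "\<exists>R\<in>{T. perfect_tree K T \<and> (\<exists>A\<in>X. splits_only_in A T)}. perfect_tree K R \<and> R \<subseteq> S"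
    if "perfect_tree K S" "S \<subseteq> T" for S
    using that assms(2) splits_only_in_subset[OF assms(3)] by blast
  then show ?thesis using assms(1) unfolding level_embedding_def forced_def by blast
qed

lemma level_embedding_carrier:
  "level_embedding K X \<in> carrier (regular_open_completion (perfect_forcing K))"
  by (simp add: carrier_completion level_embedding_def forced_forced)

text \<open>A tree splitting only in some \<open>A'\<close> almost equal to \<open>A\<close> also
  splits only in \<open>B \<union> A'\<close>, which differs from \<open>B\<close> by the finite set
  \<open>A' - B\<close>.\<close>

lemma level_embedding_mono:
  assumes "finite (A - B)"
  shows "level_embedding K (fin_diff `` {A}) \<subseteq> level_embedding K (fin_diff `` {B})"
proof -
  have "\<exists>B'\<in>fin_diff `` {B}. splits_only_in B' T"
    if "A' \<in> fin_diff `` {A}" "splits_only_in A' T" for A' T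
  proof (intro bexI)
    show "splits_only_in (B \<union> A') T" using that(2) by (rule splits_only_in_mono) blast
    have "finite ((A' - A) \<union> (A - B))" using that(1) assms by (simp add: fin_diff_def)
    then have "finite (A' - B)" by (rule rev_finite_subset) blast
    then show "B \<union> A' \<in> fin_diff `` {B}" by (simp add: fin_diff_def Un_Diff Diff_eq_empty_iff[THEN iffD2])
  qed
  then show ?thesis unfolding level_embedding_def by (intro forced_mono) blast
qed

text \<open>A tree common to both images shrinks to one splitting only in the intersection of
  representatives of the two classes, which must be infinite. Conversely, a perfect tree splitting
  only in \<open>A \<inter> B\<close> lies in both images.\<close>

lemma compatible_level_embedding:
  assumes K: "\<And>n. Card_order (K n)" "\<And>n. natLeq <o K n" "\<And>m n. m < n \<Longrightarrow> K m <o K n"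
  shows "compatible (regular_open_completion (perfect_forcing K))
    (level_embedding K (fin_diff `` {A})) (level_embedding K (fin_diff `` {B})) \<longleftrightarrow> infinite (A \<inter> B)"
    (is "compatible ?B ?U ?V \<longleftrightarrow> _")
proof
  assume "compatible ?B ?U ?V"
  then obtain W where W: "W \<in> nonzero ?B" "W \<subseteq> ?U" "W \<subseteq> ?V"
    by (auto simp: compatible_def le_completion)
  then obtain T where T: "T \<in> ?U" "T \<in> ?V"
    by (auto simp: nonzero_def bottom_regular_open_completion)
  then obtain S A' where S: "perfect_tree K S" "S \<subseteq> T" "A' \<in> fin_diff `` {A}" "splits_only_in A' S"
    unfolding level_embedding_def forced_def by blast
  then obtain R B' where R: "perfect_tree K R" "R \<subseteq> S" "B' \<in> fin_diff `` {B}" "splits_only_in B' R"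
    using T(2) unfolding level_embedding_def forced_def by blast
  have "infinite (A' \<inter> B')"
    using infinite_split_levels[OF R(1) splits_only_in_Int] splits_only_in_subset[OF S(4) R(2)] R(4) K(2)
    by blast
  moreover have "finite ((A' - A) \<union> (B' - B))" using S(3) R(3) by (simp add: fin_diff_def)
  moreover have "A' \<inter> B' \<subseteq> (A \<inter> B) \<union> ((A' - A) \<union> (B' - B))" by blast
  ultimately show "infinite (A \<inter> B)" by (meson finite_Un finite_subset)
next
  assume "infinite (A \<inter> B)"
  then obtain S where S: "perfect_tree K S" "splits_only_in (A \<inter> B) S"
    using exists_tree_splitting_only_in K by blast
  show "compatible ?B ?U ?V"
  proof (rule compatible_completion[OF level_embedding_carrier level_embedding_carrier S(1)])
    show "S \<in> ?U" by (rule level_embedding_memI[OF S(1), of A])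
        (use splits_only_in_mono[OF S(2)] in \<open>auto simp: fin_diff_def\<close>)
    show "S \<in> ?V" by (rule level_embedding_memI[OF S(1), of B])
        (use splits_only_in_mono[OF S(2)] in \<open>auto simp: fin_diff_def\<close>)
  qed
qed

section \<open>The continuum lies below some member of the sequence\<close>

text \<open>For a copy \<open>\<mu>\<close> of \<omega>, the power \<open>\<mu> ^c natLeq\<close> is
  at least the continuum and below \<open>\<kappa>\<close>. By minimality of the supremum it cannot
  bound all \<open>K n\<close>.\<close>

lemma continuum_bounded:
  fixes \<kappa> :: "'a rel" and K :: "nat \<Rightarrow> 'a rel"
  assumes K: "\<And>n. Card_order (K n)" "\<And>n. natLeq <o K n" "\<And>n. K n <o \<kappa>"
    and sup: "is_card_sup K \<kappa>"
    and exp: "\<And>\<mu>::'a rel. Card_order \<mu> \<Longrightarrow> \<mu> <o \<kappa> \<Longrightarrow> \<mu> ^c natLeq <o \<kappa>"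
  obtains n where "|UNIV :: nat set set| <o K n"
proof -
  have lt: "natLeq <o \<kappa>" using K(2,3) ordLess_transitive by blast
  \<comment> \<open>The assumptions on exponentiation and on the supremum speak of cardinals on the
    type \<open>'a\<close>, so copies are taken there.\<close>
  obtain \<mu> :: "'a rel" where \<mu>: "natLeq =o \<mu>"
    using internalize_ordLeq[of natLeq \<kappa>] ordLess_imp_ordLeq[OF lt] by blast
  have c\<mu>: "Card_order \<mu>" using Card_order_ordIso2[OF natLeq_Card_order \<mu>] .
  have \<mu>\<kappa>: "\<mu> <o \<kappa>" using \<mu> lt ordIso_symmetric ordIso_ordLess_trans by blast
  have C: "\<mu> ^c natLeq <o \<kappa>" by (rule exp[OF c\<mu> \<mu>\<kappa>])
  have "|UNIV :: nat set set| \<le>o \<mu> ^c natLeq"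
  proof -
    have "|UNIV :: nat set set| =o ctwo ^c natLeq"
      using card_of_Pow_Func[of "UNIV :: nat set"] by (simp add: cexp_def ctwo_def Field_natLeq Field_card_of)
    moreover have "ctwo \<le>o \<mu>"
      using ordLeq_ordIso_trans[OF ordLess_imp_ordLeq[OF ctwo_ordLess_natLeq] \<mu>] .
    then have "ctwo ^c natLeq \<le>o \<mu> ^c natLeq"
      using cexp_mono1 natLeq_Card_order by blast
    ultimately show ?thesis using ordIso_ordLeq_trans by blast
  qed
  moreover have "\<exists>n. \<mu> ^c natLeq <o K n"
  proof (rule ccontr)
    assume "\<nexists>n. \<mu> ^c natLeq <o K n"
    then have le: "K n \<le>o \<mu> ^c natLeq" for n
      using K(1) Card_order_cexp card_order_on_well_order_on not_ordLess_iff_ordLeq by metis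
    obtain \<nu> :: "'a rel" where \<nu>: "\<mu> ^c natLeq =o \<nu>"
      using internalize_ordLeq[of "\<mu> ^c natLeq" \<kappa>] ordLess_imp_ordLeq[OF C] by blast
    have "Card_order \<nu>" using Card_order_ordIso2[OF Card_order_cexp \<nu>] .
    moreover have "K n \<le>o \<nu>" for n using le \<nu> ordLeq_ordIso_trans by blast
    ultimately have "\<kappa> \<le>o \<nu>" using sup unfolding is_card_sup_def by blast
    then have "\<kappa> \<le>o \<mu> ^c natLeq" using \<nu> ordIso_symmetric ordLeq_ordIso_trans by blast
    then show False using C not_ordLess_ordLeq by blast
  qed
  ultimately show ?thesis using that ordLeq_ordLess_trans by blast
qed

section \<open>Completeness of the embedding\<close>

theorem theorem5p3:
  fixes \<kappa> :: "'a rel" and K :: "nat \<Rightarrow> 'a rel"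
  assumes "singular_card \<kappa>"
    and "has_cofinality \<kappa> natLeq"
    and "\<And>n. Card_order (K n)"
    and "\<And>n. regularCard (K n)"
    and "\<And>m n. m < n \<Longrightarrow> K m <o K n"
    and "is_card_sup K \<kappa>"
    and "\<And>n. natLeq <o K n"
    and "\<And>n. K n <o \<kappa>"
    and "\<And>\<mu>::'a rel. Card_order \<mu> \<Longrightarrow> \<mu> <o \<kappa> \<Longrightarrow> \<mu> ^c natLeq <o \<kappa>"
  shows "\<exists>i. complete_embedding power_mod_fin
               (regular_open_completion (perfect_forcing K)) i"
proof
  let ?B = "regular_open_completion (perfect_forcing K)"
  let ?i = "level_embedding K"
  obtain n0 where n0: "|UNIV :: nat set set| <o K n0"
    using continuum_bounded[OF assms(3,7,8,6,9)] .
  show "complete_embedding power_mod_fin ?B ?i"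
    unfolding complete_embedding_def
  proof (intro conjI ballI impI)
    show "?i \<in> carrier power_mod_fin \<rightarrow> carrier ?B"
      by (simp add: level_embedding_carrier)
  next
    fix X Y assume "X \<in> nonzero power_mod_fin" "Y \<in> nonzero power_mod_fin" and le: "le power_mod_fin X Y"
    then obtain A B where "X = fin_diff `` {A}" "Y = fin_diff `` {B}"
      by (metis DiffD1 carrier_power_mod_finE nonzero_def)
    then show "le ?B (?i X) (?i Y)"
      using le level_embedding_mono by (simp add: le_completion le_power_mod_fin)
  next
    fix X Y assume "X \<in> carrier power_mod_fin" "Y \<in> carrier power_mod_fin"
    then obtain A B where "X = fin_diff `` {A}" "Y = fin_diff `` {B}"
      by (metis carrier_power_mod_finE)
    then show "\<not> compatible power_mod_fin X Y \<longleftrightarrow> \<not> compatible ?B (?i X) (?i Y)"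
      using compatible_level_embedding[OF assms(3,7,5)] by (simp add: compatible_power_mod_fin)
  next
    fix U assume U: "U \<in> nonzero ?B"
    then have Uc: "U \<in> carrier ?B" by (simp add: nonzero_def)
    then have Uf: "U = forced K U" by (simp add: carrier_completion)
    obtain T where T: "T \<in> U" using U by (auto simp: nonzero_def bottom_regular_open_completion)
    then have "perfect_tree K T" using Uf unfolding forced_def by blast
    \<comment> \<open>The class of \<open>D\<close> is the required element: an infinite
      \<open>A\<close> almost contained in \<open>D\<close> meets \<open>D\<close> in an infinite
      set, to which the splitting levels below \<open>T\<close> can be restricted.\<close>
    then obtain D where D: "infinite D"
      "\<And>J. J \<subseteq> D \<Longrightarrow> infinite J \<Longrightarrow> \<exists>S. S \<subseteq> T \<and> perfect_tree K S \<and> splits_only_in J S"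
      using exists_uniform_levels[of K T n0, OF _ assms(3,4,7,5) n0] by blast
    show "\<exists>X\<in>nonzero power_mod_fin. \<forall>Y\<in>nonzero power_mod_fin.
        le power_mod_fin Y X \<longrightarrow> compatible ?B (?i Y) U"
    proof (intro bexI ballI impI)
      show "fin_diff `` {D} \<in> nonzero power_mod_fin" using D(1) by (simp add: nonzero_power_mod_fin)
      fix Y assume Y: "Y \<in> nonzero power_mod_fin" "le power_mod_fin Y (fin_diff `` {D})"
      then obtain A where A: "Y = fin_diff `` {A}" by (metis DiffD1 carrier_power_mod_finE nonzero_def)
      have fin: "infinite A" "finite (A - D)"
        using Y unfolding A by (auto simp: nonzero_power_mod_fin le_power_mod_fin)
      then have "infinite (A \<inter> D)" by (metis Int_Diff_Un finite_Un)
      then obtain S where S: "S \<subseteq> T" "perfect_tree K S" "splits_only_in (A \<inter> D) S"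
        using D(2)[of "A \<inter> D"] by blast
      have "S \<in> U" using T Uf forced_down[of T K U S] S by simp
      moreover have "S \<in> ?i Y"
        by (rule level_embedding_memI[OF S(2), of A])
          (use splits_only_in_mono[OF S(3)] in \<open>auto simp: A fin_diff_def\<close>)
      ultimately show "compatible ?B (?i Y) U"
        using compatible_completion[OF level_embedding_carrier Uc S(2)] by blast
    qed
  qed
qed

end
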